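(* Let $(P,\mathrm{Ex},\langle\!\langle\cdot,\cdot\rangle\!\rangle)$ be a linear realisability situation such that the measurement is symmetric, and in which there exist elements $id, \tau \in P$ such that for all $p, q \in P$: \[ \begin{array}{lll} \mathrm{Ex}(id, p) = p, &\hspace{2em}& \langle\!\langle id, p\rangle\!\rangle = 0, \\ \mathrm{Ex}(\mathrm{Ex}(\tau, p), q) = \mathrm{Ex}(q, p), && \langle\!\langle \tau, p\rangle\!\rangle = 0. \end{array} \] Then $(\mathbf{\Pi}, \subseteq, \multimap, \mathbf{\Pi} \setminus \{\emptyset\})$, where $\mathbf{\Pi}$ is the set of all types, is a consistent linear implicative algebra.
   Context: Fix a commutative group $(\Theta,+,0)$. A linear realisability situation is a triple $(P,\mathrm{Ex},\langle\!\langle\cdot,\cdot\rangle\!\rangle)$ where $P$ is a set (of programs), $\mathrm{Ex}:P\times P\to P$ is an associative operation, and $\langle\!\langle\cdot,\cdot\rangle\!\rangle:P\times P\to\Theta$ satisfies $\langle\!\langle \mathrm{Ex}(p,q),r\rangle\!\rangle+\langle\!\langle p,q\rangle\!\rangle=\langle\!\langle p,\mathrm{Ex}(q,r)\rangle\!\rangle+\langle\!\langle q,r\rangle\!\rangle$ for all $p,q,r$. A project is a pair $\alpha\cdot a\in\Theta\times P$, with $\mathrm{Ex}(\alpha\cdot a,\beta\cdot b)=(\alpha+\beta+\langle\!\langle a,b\rangle\!\rangle)\cdot\mathrm{Ex}(a,b)$ and $\langle\!\langle\alpha\cdot a,\beta\cdot b\rangle\!\rangle=\alpha+\beta+\langle\!\langle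 a,b\rangle\!\rangle$. Given a fixed subset $\mathcal{O}\subseteq\Theta$ (the pole), $\alpha\cdot a\perp\beta\cdot b$ iff $\langle\!\langle\alpha\cdot a,\beta\cdot b\rangle\!\rangle\in\mathcal{O}$; for a set $X$ of projects, $X^\perp=\{\alpha\cdot a\mid\forall \xi\cdot x\in X,\ \xi\cdot x\perp\alpha\cdot a\}$. Types are sets $A$ of projects with $A=A^{\perp\perp}$; $\mathbf{\Pi}$ is the set of types, and $A\multimap B=\{\xi\cdot x\mid\forall\alpha\cdot a\in A,\ \mathrm{Ex}(\xi\cdot x,\alpha\cdot a)\in B\}$. An implicative structure is a complete lattice $(\mathscr{A},\preceq)$ with a binary operation $\multimap$ antitone in its first and monotone in its second argument, with $a\multimap\bigwedge_{b\in B}b=\bigwedge_{b\in B}(a\multimap b)$. With $\mathbf{I}^\mathscr{A}=\bigwedge_a(a\multimap a)$, $\mathbf{B}^\mathscr{A}=\bigwedge_{a,b,c}((b\multimap c)\multimap(a\multimap b)\multimap a\multimap c)$, $\mathbf{C}^\mathscr{A}=\bigwedge_{a,b,c}((a\multimap b\multimap c)\multimap b\multimap a\multimap c)$, a linear separator is a subset $S\subseteq\mathscr{A}$ that is upward closed, contains $\mathbf{I}^\mathscr{A},\mathbf{B}^\mathscr{A},\mathbf{C}^\mathscr{A}$, and is closed under modus ponens ($a\in S$ and $a\multimap b\in S$ imply $b\in S$); it is consistent if $\bot\notin S$. A (consistent) linear implicative algebra is an implicative structure equipped with a (consistent) linear separator.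
   Formalization: Consistency is claimed only when the pole 𝒪 is a proper subset of Θ; for 𝒪 = Θ the only type is the set of all projects, so ⊥ is nonempty and the algebra is inconsistent. The rest holds for every pole. *)

theory Defs
  imports "HOL-Algebra.Complete_Lattice"
begin

locale linear_realisability_situation =
  fixes exec :: "'p \<Rightarrow> 'p \<Rightarrow> 'p"
    and meas :: "'p \<Rightarrow> 'p \<Rightarrow> 'th::ab_group_add"
  assumes exec_assoc: "exec (exec p q) r = exec p (exec q r)"
    and meas_exec: "meas (exec p q) r + meas p q = meas p (exec q r) + meas q r"

type_synonym ('th, 'p) project = "'th \<times> 'p"

definition proj_meas ::
  "('p \<Rightarrow> 'p \<Rightarrow> 'th::ab_group_add) \<Rightarrow> ('th, 'p) project \<Rightarrow> ('th, 'p) project \<Rightarrow> 'th" where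
  "proj_meas meas x y = fst x + fst y + meas (snd x) (snd y)"

definition proj_exec ::
  "('p \<Rightarrow> 'p \<Rightarrow> 'p) \<Rightarrow> ('p \<Rightarrow> 'p \<Rightarrow> 'th::ab_group_add)
    \<Rightarrow> ('th, 'p) project \<Rightarrow> ('th, 'p) project \<Rightarrow> ('th, 'p) project" where
  "proj_exec exec meas x y =
     (fst x + fst y + meas (snd x) (snd y), exec (snd x) (snd y))"

definition orthogonal ::
  "('p \<Rightarrow> 'p \<Rightarrow> 'th::ab_group_add) \<Rightarrow> 'th set
    \<Rightarrow> ('th, 'p) project \<Rightarrow> ('th, 'p) project \<Rightarrow> bool" where
  "orthogonal meas Pole x y \<longleftrightarrow> proj_meas meas x y \<in> Pole"

definition orth ::
  "('p \<Rightarrow> 'p \<Rightarrow> 'th::ab_group_add) \<Rightarrow> 'th set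
    \<Rightarrow> ('th, 'p) project set \<Rightarrow> ('th, 'p) project set" where
  "orth meas Pole X = {y. \<forall>x\<in>X. orthogonal meas Pole x y}"

definition types ::
  "('p \<Rightarrow> 'p \<Rightarrow> 'th::ab_group_add) \<Rightarrow> 'th set \<Rightarrow> ('th, 'p) project set set" where
  "types meas Pole = {A. A = orth meas Pole (orth meas Pole A)}"

definition lollipop ::
  "('p \<Rightarrow> 'p \<Rightarrow> 'p) \<Rightarrow> ('p \<Rightarrow> 'p \<Rightarrow> 'th::ab_group_add)
    \<Rightarrow> ('th, 'p) project set \<Rightarrow> ('th, 'p) project set \<Rightarrow> ('th, 'p) project set" where
  "lollipop exec meas A B = {x. \<forall>a\<in>A. proj_exec exec meas x a \<in> B}"

definition type_order ::
  "('p \<Rightarrow> 'p \<Rightarrow> 'th::ab_group_add) \<Rightarrow> 'th set \<Rightarrow> ('th, 'p) project set gorder" where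
  "type_order meas Pole = \<lparr>carrier = types meas Pole, eq = (=), le = (\<subseteq>)\<rparr>"

locale implicative_structure = complete_lattice L for L (structure) +
  fixes imp :: "'a \<Rightarrow> 'a \<Rightarrow> 'a" (infixr \<open>\<rightarrow>\<^sub>l\<close> 60)
  assumes imp_closed: "\<lbrakk>a \<in> carrier L; b \<in> carrier L\<rbrakk> \<Longrightarrow> a \<rightarrow>\<^sub>l b \<in> carrier L"
    and imp_antitone: "\<lbrakk>a \<in> carrier L; a' \<in> carrier L; b \<in> carrier L; a \<sqsubseteq> a'\<rbrakk>
      \<Longrightarrow> a' \<rightarrow>\<^sub>l b \<sqsubseteq> a \<rightarrow>\<^sub>l b"
    and imp_mono: "\<lbrakk>a \<in> carrier L; b \<in> carrier L; b' \<in> carrier L; b \<sqsubseteq> b'\<rbrakk>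
      \<Longrightarrow> a \<rightarrow>\<^sub>l b \<sqsubseteq> a \<rightarrow>\<^sub>l b'"
    and imp_inf: "\<lbrakk>a \<in> carrier L; B \<subseteq> carrier L\<rbrakk>
      \<Longrightarrow> a \<rightarrow>\<^sub>l \<Sqinter>B = \<Sqinter>{a \<rightarrow>\<^sub>l b | b. b \<in> B}"

definition comb_I :: "'a gorder \<Rightarrow> ('a \<Rightarrow> 'a \<Rightarrow> 'a) \<Rightarrow> 'a" where
  "comb_I L imp = \<Sqinter>\<^bsub>L\<^esub>{imp a a | a. a \<in> carrier L}"

definition comb_B :: "'a gorder \<Rightarrow> ('a \<Rightarrow> 'a \<Rightarrow> 'a) \<Rightarrow> 'a" where
  "comb_B L imp = \<Sqinter>\<^bsub>L\<^esub>{imp (imp b c) (imp (imp a b) (imp a c)) | a b c.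
     a \<in> carrier L \<and> b \<in> carrier L \<and> c \<in> carrier L}"

definition comb_C :: "'a gorder \<Rightarrow> ('a \<Rightarrow> 'a \<Rightarrow> 'a) \<Rightarrow> 'a" where
  "comb_C L imp = \<Sqinter>\<^bsub>L\<^esub>{imp (imp a (imp b c)) (imp b (imp a c)) | a b c.
     a \<in> carrier L \<and> b \<in> carrier L \<and> c \<in> carrier L}"

definition linear_separator :: "'a gorder \<Rightarrow> ('a \<Rightarrow> 'a \<Rightarrow> 'a) \<Rightarrow> 'a set \<Rightarrow> bool" where
  "linear_separator L imp S \<longleftrightarrow>
     S \<subseteq> carrier L \<and>
     (\<forall>a\<in>S. \<forall>b\<in>carrier L. a \<sqsubseteq>\<^bsub>L\<^esub> b \<longrightarrow> b \<in> S) \<and>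
     comb_I L imp \<in> S \<and> comb_B L imp \<in> S \<and> comb_C L imp \<in> S \<and>
     (\<forall>a\<in>carrier L. \<forall>b\<in>carrier L. a \<in> S \<and> imp a b \<in> S \<longrightarrow> b \<in> S)"

definition linear_implicative_algebra ::
  "'a gorder \<Rightarrow> ('a \<Rightarrow> 'a \<Rightarrow> 'a) \<Rightarrow> 'a set \<Rightarrow> bool" where
  "linear_implicative_algebra L imp S \<longleftrightarrow>
     implicative_structure L imp \<and> linear_separator L imp S"

definition consistent_linear_implicative_algebra ::
  "'a gorder \<Rightarrow> ('a \<Rightarrow> 'a \<Rightarrow> 'a) \<Rightarrow> 'a set \<Rightarrow> bool" where
  "consistent_linear_implicative_algebra L imp S \<longleftrightarrow>
     linear_implicative_algebra L imp S \<and> \<bottom>\<^bsub>L\<^esub> \<notin> S"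

text \<open>
  Consistency requires the pole to be a proper subset: for the full pole the only type is the set
  of all projects, so the least type is non-empty and belongs to every separator.
\<close>

lemma types_full_pole: "types meas UNIV = {UNIV}"
  by (auto simp: types_def orth_def orthogonal_def)

lemma full_pole_not_consistent:
  "\<not> consistent_linear_implicative_algebra (type_order meas UNIV) imp (types meas UNIV - {{}})"
proof -
  have "\<bottom>\<^bsub>type_order meas UNIV\<^esub> = UNIV"
    by (simp add: bottom_def type_order_def types_full_pole least_def Upper_def)
  then show ?thesis
    by (simp add: consistent_linear_implicative_algebra_def types_full_pole)
qed

end

theory Submission
  imports Defs
begin

text \<open>
  Two projects are orthogonal iff the scalar of their product lies in the pole, so associativity of
  the product makes \<open>x \<mapsto> x a\<close> adjoint to \<open>y \<mapsto> a y\<close>: \<open>x a \<perp> y\<close> iff \<open>x \<perp> a y\<close>. Hence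
  \<open>A \<multimap> B = (A B\<^sup>\<perp>)\<^sup>\<perp>\<close> is a type, and since types are closed under intersections they form an
  implicative structure. The unit project \<open>0 \<cdot> id\<close> lies in \<open>A \<multimap> B\<close> iff \<open>A \<subseteq> B\<close>, so inhabiting
  \<open>I\<close>, \<open>B\<close> and \<open>C\<close> amounts to proving inclusions of types. For \<open>C\<close> this uses that \<open>Ex\<close> is
  commutative, which \<open>\<tau>\<close> forces: associativity turns the exchange law into \<open>\<tau>(pq) = qp\<close>, so
  \<open>p = id\<close> gives \<open>\<tau>q = q id\<close>, and then \<open>qp = (\<tau>p)q = (p id)q = p(id q) = pq\<close>.
\<close>

lemma (in semigroup) commute_if_exchanger:
  assumes left_unit: "\<And>a. e \<^bold>* a = a"
    and exchanger: "\<And>a b. (t \<^bold>* a) \<^bold>* b = b \<^bold>* a"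
  shows "a \<^bold>* b = b \<^bold>* a"
proof -
  have "t \<^bold>* b = b \<^bold>* e"
    using exchanger[of e b] by (simp add: assoc left_unit)
  then have "(t \<^bold>* b) \<^bold>* a = b \<^bold>* a"
    by (simp add: assoc left_unit)
  then show ?thesis
    by (simp add: exchanger)
qed

lemma orth_antimono: "X \<subseteq> Y \<Longrightarrow> orth meas Pole Y \<subseteq> orth meas Pole X"
  by (auto simp: orth_def)

lemma orth_UN: "orth meas Pole (\<Union>i\<in>I. X i) = (\<Inter>i\<in>I. orth meas Pole (X i))"
  by (auto simp: orth_def)

lemma orth_UNIV:
  assumes "Pole \<noteq> UNIV"
  shows "orth meas Pole UNIV = {}"
proof -
  obtain \<theta> where "\<theta> \<notin> Pole"
    using assms by auto
  then have "\<not> orthogonal meas Pole (\<theta> - fst y - meas p (snd y), p) y" for p y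
    by (simp add: orthogonal_def proj_meas_def)
  then show ?thesis
    unfolding orth_def by blast
qed

lemma lollipop_antimono: "A \<subseteq> A' \<Longrightarrow> lollipop exec meas A' B \<subseteq> lollipop exec meas A B"
  by (auto simp: lollipop_def)

lemma lollipop_mono: "B \<subseteq> B' \<Longrightarrow> lollipop exec meas A B \<subseteq> lollipop exec meas A B'"
  by (auto simp: lollipop_def)

lemma lollipop_Inter: "lollipop exec meas A (\<Inter>\<B>) = \<Inter>{lollipop exec meas A B | B. B \<in> \<B>}"
  by (auto simp: lollipop_def)

lemma lollipop_nonempty_target:
  "\<lbrakk>lollipop exec meas A B \<noteq> {}; A \<noteq> {}\<rbrakk> \<Longrightarrow> B \<noteq> {}"
  by (auto simp: lollipop_def)

lemma carrier_type_order [simp]: "carrier (type_order meas Pole) = types meas Pole"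
  and le_type_order [simp]: "A \<sqsubseteq>\<^bsub>type_order meas Pole\<^esub> B \<longleftrightarrow> A \<subseteq> B"
  by (simp_all add: type_order_def)

lemma partial_order_type_order: "partial_order (type_order meas Pole)"
  by unfold_locales (auto simp: type_order_def)

locale symmetric_measurement =
  fixes meas :: "'p \<Rightarrow> 'p \<Rightarrow> 'th::ab_group_add" and Pole :: "'th set"
  assumes meas_commute: "meas p q = meas q p"
begin

abbreviation perp (infix \<open>\<perp>\<close> 50) where "x \<perp> y \<equiv> orthogonal meas Pole x y"
abbreviation dual (\<open>_\<^sup>\<perp>\<close> [1000] 1000) where "X\<^sup>\<perp> \<equiv> orth meas Pole X"
abbreviation Types where "Types \<equiv> types meas Pole"
abbreviation Type_order where "Type_order \<equiv> type_order meas Pole"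

lemma orthogonal_commute: "x \<perp> y \<longleftrightarrow> y \<perp> x"
  by (simp add: orthogonal_def proj_meas_def meas_commute add.commute)

lemma subset_biorth: "X \<subseteq> X\<^sup>\<perp>\<^sup>\<perp>"
  by (auto simp: orth_def orthogonal_commute)

lemma orth_type: "X\<^sup>\<perp> \<in> Types"
  unfolding types_def by (intro CollectI equalityI subset_biorth orth_antimono)

lemma Inter_type:
  assumes "\<B> \<subseteq> Types"
  shows "\<Inter>\<B> \<in> Types"
proof -
  have "\<Inter>\<B> = (\<Inter>B\<in>\<B>. B\<^sup>\<perp>\<^sup>\<perp>)"
    using assms by (auto simp: types_def)
  also have "\<dots> = (\<Union>B\<in>\<B>. B\<^sup>\<perp>)\<^sup>\<perp>"
    by (simp only: orth_UN)
  finally show ?thesis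
    by (simp only: orth_type)
qed

lemma greatest_Inter:
  "\<B> \<subseteq> Types \<Longrightarrow> greatest Type_order (\<Inter>\<B>) (Lower Type_order \<B>)"
  using Inter_type by (auto simp: greatest_def Lower_def)

lemma complete_lattice_type_order: "complete_lattice Type_order"
proof (rule partial_order.complete_lattice_criterion1[OF partial_order_type_order])
  show "\<exists>T. greatest Type_order T (carrier Type_order)"
    using Inter_type[of "{}"] by (auto simp: greatest_def)
qed (use greatest_Inter in auto)

interpretation type_lattice: complete_lattice Type_order
  by (rule complete_lattice_type_order)

lemma inf_type_order: "\<B> \<subseteq> Types \<Longrightarrow> \<Sqinter>\<^bsub>Type_order\<^esub> \<B> = \<Inter>\<B>"
  using type_lattice.greatest_unique[OF type_lattice.inf_glb greatest_Inter] by simp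

lemma inf_inhabited_type:
  assumes types: "\<B> \<subseteq> Types" and inhabited: "\<And>B. B \<in> \<B> \<Longrightarrow> x \<in> B"
  shows "\<Sqinter>\<^bsub>Type_order\<^esub> \<B> \<in> Types - {{}}"
proof -
  have "x \<in> \<Inter>\<B>"
    using inhabited by blast
  then show ?thesis
    unfolding inf_type_order[OF types] using Inter_type[OF types] by blast
qed

lemma bottom_type_order:
  assumes "Pole \<noteq> UNIV"
  shows "\<bottom>\<^bsub>Type_order\<^esub> = {}"
proof -
  have "{} \<in> Types"
    using orth_type[of UNIV] by (simp add: orth_UNIV[OF assms])
  then show ?thesis
    using type_lattice.bottom_lower by auto
qed

end

context linear_realisability_situation
begin

abbreviation mult (infixl \<open>\<star>\<close> 70) where "x \<star> y \<equiv> proj_exec exec meas x y"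
abbreviation implies (infixr \<open>\<multimap>\<close> 60) where "A \<multimap> B \<equiv> lollipop exec meas A B"

lemma mult_assoc: "(x \<star> y) \<star> z = x \<star> (y \<star> z)"
  using meas_exec[of "snd x" "snd y" "snd z"]
  by (simp add: proj_exec_def exec_assoc algebra_simps)

lemma orthogonal_iff_fst_mult: "orthogonal meas Pole x y \<longleftrightarrow> fst (x \<star> y) \<in> Pole"
  by (simp add: orthogonal_def proj_meas_def proj_exec_def)

lemma orthogonal_mult: "orthogonal meas Pole (x \<star> y) z \<longleftrightarrow> orthogonal meas Pole x (y \<star> z)"
  by (simp only: orthogonal_iff_fst_mult mult_assoc)

lemma compose_lollipop: "B \<multimap> C \<subseteq> (A \<multimap> B) \<multimap> A \<multimap> C"
  by (auto simp: lollipop_def mult_assoc)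

end

locale symmetric_realisability =
  linear_realisability_situation exec meas + symmetric_measurement meas Pole
  for exec :: "'p \<Rightarrow> 'p \<Rightarrow> 'p" and meas :: "'p \<Rightarrow> 'p \<Rightarrow> 'th::ab_group_add" and Pole :: "'th set"
begin

lemma mult_mem_type_iff:
  assumes "B \<in> Types"
  shows "x \<star> a \<in> B \<longleftrightarrow> (\<forall>y\<in>B\<^sup>\<perp>. a \<star> y \<perp> x)"
proof -
  have "x \<star> a \<in> B \<longleftrightarrow> x \<star> a \<in> B\<^sup>\<perp>\<^sup>\<perp>"
    using assms by (simp add: types_def)
  also have "\<dots> \<longleftrightarrow> (\<forall>y\<in>B\<^sup>\<perp>. x \<star> a \<perp> y)"
    by (simp add: orth_def[of _ _ "B\<^sup>\<perp>"] orthogonal_commute)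
  also have "\<dots> \<longleftrightarrow> (\<forall>y\<in>B\<^sup>\<perp>. a \<star> y \<perp> x)"
    by (simp only: orthogonal_mult[of Pole x] orthogonal_commute[of x])
  finally show ?thesis .
qed

lemma lollipop_eq_orth:
  assumes "B \<in> Types"
  shows "A \<multimap> B = {a \<star> y | a y. a \<in> A \<and> y \<in> B\<^sup>\<perp>}\<^sup>\<perp>"
  unfolding lollipop_def mult_mem_type_iff[OF assms] orth_def[of _ _ "Collect _"] by blast

lemma lollipop_type: "B \<in> Types \<Longrightarrow> A \<multimap> B \<in> Types"
  by (simp add: lollipop_eq_orth orth_type)

lemma implicative_structure_types: "implicative_structure Type_order (lollipop exec meas)"
proof -
  interpret complete_lattice Type_order
    by (rule complete_lattice_type_order)
  show ?thesis
  proof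
    fix A \<B>
    assume "A \<in> carrier Type_order" "\<B> \<subseteq> carrier Type_order"
    then have "\<B> \<subseteq> Types" "{A \<multimap> B | B. B \<in> \<B>} \<subseteq> Types"
      by (auto intro: lollipop_type)
    then show "A \<multimap> \<Sqinter>\<^bsub>Type_order\<^esub> \<B> = \<Sqinter>\<^bsub>Type_order\<^esub> {A \<multimap> B | B. B \<in> \<B>}"
      by (simp add: inf_type_order lollipop_Inter)
  qed (simp_all add: lollipop_type lollipop_antimono lollipop_mono)
qed

end

locale unital_realisability = linear_realisability_situation exec meas
  for exec :: "'p \<Rightarrow> 'p \<Rightarrow> 'p" and meas :: "'p \<Rightarrow> 'p \<Rightarrow> 'th::ab_group_add" +
  fixes ident :: 'p
  assumes exec_ident: "exec ident p = p"
    and meas_ident: "meas ident p = 0"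
begin

abbreviation unit_project where "unit_project \<equiv> (0, ident)"

lemma unit_mult: "unit_project \<star> x = x"
  by (simp add: proj_exec_def exec_ident meas_ident)

lemma unit_in_lollipop_iff: "unit_project \<in> A \<multimap> B \<longleftrightarrow> A \<subseteq> B"
  by (auto simp: lollipop_def unit_mult)

end

locale commutative_realisability =
  symmetric_realisability exec meas Pole + unital_realisability exec meas ident
  for exec :: "'p \<Rightarrow> 'p \<Rightarrow> 'p" and meas :: "'p \<Rightarrow> 'p \<Rightarrow> 'th::ab_group_add"
    and Pole :: "'th set" and ident :: 'p +
  assumes exec_commute: "exec p q = exec q p"
begin

lemma mult_commute: "x \<star> y = y \<star> x"
  by (simp add: proj_exec_def exec_commute meas_commute add.commute)

lemma exchange_lollipop: "A \<multimap> B \<multimap> C \<subseteq> B \<multimap> A \<multimap> C"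
proof
  fix x
  assume x: "x \<in> A \<multimap> B \<multimap> C"
  have "(x \<star> b) \<star> a \<in> C" if "a \<in> A" "b \<in> B" for a b
  proof -
    have "(x \<star> b) \<star> a = (x \<star> a) \<star> b"
      by (simp only: mult_assoc mult_commute[of b a])
    then show ?thesis
      using x that by (simp add: lollipop_def)
  qed
  then show "x \<in> B \<multimap> A \<multimap> C"
    by (simp add: lollipop_def)
qed

lemma linear_separator_types:
  "linear_separator Type_order (lollipop exec meas) (Types - {{}})"
  unfolding linear_separator_def
proof (intro conjI)
  show "comb_I Type_order (lollipop exec meas) \<in> Types - {{}}"
    unfolding comb_I_def
    by (rule inf_inhabited_type[of _ unit_project]) (auto simp: lollipop_type unit_in_lollipop_iff)
  show "comb_B Type_order (lollipop exec meas) \<in> Types - {{}}"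
    unfolding comb_B_def
    by (rule inf_inhabited_type[of _ unit_project])
      (auto simp: lollipop_type unit_in_lollipop_iff compose_lollipop)
  show "comb_C Type_order (lollipop exec meas) \<in> Types - {{}}"
    unfolding comb_C_def
    by (rule inf_inhabited_type[of _ unit_project])
      (auto simp: lollipop_type unit_in_lollipop_iff exchange_lollipop)
  show "\<forall>A\<in>carrier Type_order. \<forall>B\<in>carrier Type_order.
      A \<in> Types - {{}} \<and> A \<multimap> B \<in> Types - {{}} \<longrightarrow> B \<in> Types - {{}}"
    using lollipop_nonempty_target by fastforce
qed auto

lemma linear_implicative_algebra_types:
  "linear_implicative_algebra Type_order (lollipop exec meas) (Types - {{}})"
  by (simp add: linear_implicative_algebra_def implicative_structure_types linear_separator_types)

end

theorem theorem3p1: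
  fixes exec :: "'p \<Rightarrow> 'p \<Rightarrow> 'p"
    and meas :: "'p \<Rightarrow> 'p \<Rightarrow> 'th::ab_group_add"
    and Pole :: "'th set"
    and ident \<tau> :: 'p
  assumes "linear_realisability_situation exec meas"
    and "\<forall>p q. meas p q = meas q p"
    and "\<forall>p. exec ident p = p"
    and "\<forall>p. meas ident p = 0"
    and "\<forall>p q. exec (exec \<tau> p) q = exec q p"
    and "\<forall>p. meas \<tau> p = 0"
  shows "linear_implicative_algebra
           (type_order meas Pole) (lollipop exec meas) (types meas Pole - {{}})
       \<and> (Pole \<noteq> UNIV \<longrightarrow> consistent_linear_implicative_algebra
           (type_order meas Pole) (lollipop exec meas) (types meas Pole - {{}}))"
proof -
  interpret linear_realisability_situation exec meas
    by fact
  interpret semigroup exec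
    by unfold_locales (rule exec_assoc)
  have "exec p q = exec q p" for p q
    using assms(3,5) by (intro commute_if_exchanger[of ident \<tau>]) auto
  then interpret commutative_realisability exec meas Pole ident
    using assms(2-4) by unfold_locales auto
  show ?thesis
    using linear_implicative_algebra_types bottom_type_order
    by (simp add: consistent_linear_implicative_algebra_def)
qed

end
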